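(* Let a spectrahedron $S\subseteq\mathbb{R}^n$ be given by $S=\{x\in\mathbb{R}^n \mid A_0+\sum_{i=1}^n x_iA_i\succeq 0\}$, where $A_0,\ldots,A_n$ are real symmetric $m\times m$ matrices. Then there exist an integer $k$ with $0\le k\le m$ and a cubic polynomial $p(x,y)$ in the $n+k$ variables $(x,y)\in\mathbb{R}^n\times\mathbb{R}^k$ such that $S$ is a projection of the convexity region $CR_p$ of $p$, i.e., $$S=\{x\in\mathbb{R}^n \mid \exists y\in\mathbb{R}^k \text{ such that } (x,y)\in CR_p\}.$$ Furthermore, for this same $p$, the interior of $S$ is the projection onto the $x$ variables of the set of local minima of $p$.
   Context: A cubic polynomial is a real polynomial all of whose monomials have degree at most 3. $M\succeq 0$ means the symmetric matrix $M$ is positive semidefinite. The convexity region of a polynomial $p:\mathbb{R}^N\to\mathbb{R}$ is $CR_p=\{w\in\mathbb{R}^N \mid \nabla^2 p(w)\succeq 0\}$. A point $\bar w$ is a local minimum of $p$ if there is $\epsilon>0$ such that $p(\bar w)\le p(w)$ for all $w$ with $\|w-\bar w\|\le\epsilon$. Interior means interior in $\mathbb{R}^n$ (possibly empty). *)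

theory Defs
  imports
    "HOL-Analysis.Analysis"
    "HOL-Library.Poly_Mapping"
    "Jordan_Normal_Form.Matrix"
begin

text \<open>
  Euclidean space of dimension \<open>N\<close> is rendered as \<open>carrier_vec N\<close>, since the number of
  additional variables is existentially quantified. Coordinates are numbered from 0.
  The dimension is an explicit argument of the distance so that the distance is
  symmetric also outside of the carrier, as the locale \<open>Metric_space\<close> demands.
\<close>

definition euclid_dist :: "nat \<Rightarrow> real Matrix.vec \<Rightarrow> real Matrix.vec \<Rightarrow> real" where
  "euclid_dist N x y = L2_set (\<lambda>i. vec_index x i - vec_index y i) {..<N}"

lemma Metric_space_euclid_dist: "Metric_space (carrier_vec N) (euclid_dist N)"
proof
  fix x y z :: "real Matrix.vec"
  show "0 \<le> euclid_dist N x y"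
    by (simp add: euclid_dist_def)
  show "euclid_dist N x y = euclid_dist N y x"
    by (simp add: euclid_dist_def L2_set_def power2_commute)
  show "euclid_dist N x y = 0 \<longleftrightarrow> x = y" if "x \<in> carrier_vec N" "y \<in> carrier_vec N"
    using that by (auto simp: euclid_dist_def L2_set_eq_0_iff)
  have "L2_set (\<lambda>i. (vec_index x i - vec_index y i) + (vec_index y i - vec_index z i)) {..<N}
        \<le> euclid_dist N x y + euclid_dist N y z"
    unfolding euclid_dist_def by (rule L2_set_triangle_ineq)
  then show "euclid_dist N x z \<le> euclid_dist N x y + euclid_dist N y z"
    by (simp add: euclid_dist_def)
qed

definition euclid_topology :: "nat \<Rightarrow> real Matrix.vec topology" where
  "euclid_topology N = Metric_space.mtopology (carrier_vec N) (euclid_dist N)"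

definition psd :: "nat \<Rightarrow> real mat \<Rightarrow> bool" where
  "psd N M \<longleftrightarrow> M \<in> carrier_mat N N \<and> transpose_mat M = M \<and>
    (\<forall>v\<in>carrier_vec N. 0 \<le> scalar_prod v (M *\<^sub>v v))"

text \<open>
  The matrix \<open>A\<^sub>0 + x\<^sub>1 A\<^sub>1 + \<dots> + x\<^sub>n A\<^sub>n\<close>; the coordinate \<open>x\<^sub>i\<close> is stored at index \<open>i - 1\<close>.
\<close>
definition matrix_pencil :: "nat \<Rightarrow> nat \<Rightarrow> (nat \<Rightarrow> real mat) \<Rightarrow> real Matrix.vec \<Rightarrow> real mat" where
  "matrix_pencil n m A x =
    mat m m (\<lambda>(r, c). A 0 $$ (r, c) + (\<Sum>i=1..n. vec_index x (i - 1) * A i $$ (r, c)))"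

definition spectrahedron :: "nat \<Rightarrow> nat \<Rightarrow> (nat \<Rightarrow> real mat) \<Rightarrow> real Matrix.vec set" where
  "spectrahedron n m A = {x \<in> carrier_vec n. psd m (matrix_pencil n m A x)}"

text \<open>
  A real multivariate polynomial is a finitely supported family of coefficients indexed by
  monomials, a monomial being a finitely supported family of exponents indexed by variables.
\<close>
type_synonym real_mpoly = "(nat \<Rightarrow>\<^sub>0 nat) \<Rightarrow>\<^sub>0 real"

definition mpoly_eval :: "real_mpoly \<Rightarrow> real Matrix.vec \<Rightarrow> real" where
  "mpoly_eval p w =
    (\<Sum>\<alpha>\<in>Poly_Mapping.keys p. Poly_Mapping.lookup p \<alpha> *
      (\<Prod>i\<in>Poly_Mapping.keys \<alpha>. vec_index w i ^ Poly_Mapping.lookup \<alpha> i))"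

definition monom_degree :: "(nat \<Rightarrow>\<^sub>0 nat) \<Rightarrow> nat" where
  "monom_degree \<alpha> = (\<Sum>i\<in>Poly_Mapping.keys \<alpha>. Poly_Mapping.lookup \<alpha> i)"

definition cubic_polynomial :: "nat \<Rightarrow> real_mpoly \<Rightarrow> bool" where
  "cubic_polynomial N p \<longleftrightarrow>
    (\<forall>\<alpha>\<in>Poly_Mapping.keys p. Poly_Mapping.keys \<alpha> \<subseteq> {..<N} \<and> monom_degree \<alpha> \<le> 3)"

definition partial_deriv ::
  "nat \<Rightarrow> nat \<Rightarrow> (real Matrix.vec \<Rightarrow> real) \<Rightarrow> real Matrix.vec \<Rightarrow> real" where
  "partial_deriv N i f w = deriv (\<lambda>t. f (w + t \<cdot>\<^sub>v unit_vec N i)) 0"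

definition hessian :: "nat \<Rightarrow> (real Matrix.vec \<Rightarrow> real) \<Rightarrow> real Matrix.vec \<Rightarrow> real mat" where
  "hessian N f w = mat N N (\<lambda>(i, j). partial_deriv N i (partial_deriv N j f) w)"

definition convexity_region :: "nat \<Rightarrow> real_mpoly \<Rightarrow> real Matrix.vec set" where
  "convexity_region N p = {w \<in> carrier_vec N. psd N (hessian N (mpoly_eval p) w)}"

definition local_minima :: "nat \<Rightarrow> real_mpoly \<Rightarrow> real Matrix.vec set" where
  "local_minima N p = {w \<in> carrier_vec N. \<exists>\<epsilon>>0. \<forall>v\<in>carrier_vec N.
    euclid_dist N v w \<le> \<epsilon> \<longrightarrow> mpoly_eval p w \<le> mpoly_eval p v}"

end

theory Submission
  imports Defs
begin

text \<open>
  Write \<open>A(x)\<close> for the pencil and take \<open>p(x, y) = y\<^sup>T A(x) y\<close> with \<open>k = m\<close>. The \<open>yy\<close>-block of the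
  Hessian of \<open>p\<close> is \<open>2 A(x)\<close>, and at \<open>y = 0\<close> the remaining blocks vanish; so \<open>S\<close> is the
  projection of the convexity region. If \<open>x\<close> is interior to \<open>S\<close>, then \<open>p \<ge> 0 = p(x, 0)\<close> near
  \<open>(x, 0)\<close>. Conversely, if \<open>(x, y)\<close> is a local minimum, then \<open>p(x', y) = p(x, y)\<close> for \<open>x'\<close> near
  \<open>x\<close>, since \<open>p\<close> is affine in its first argument, and
  \<open>p(x', y + t z) + p(x', y - t z) = 2 p(x', y) + 2 t\<^sup>2 p(x', z)\<close> shows that \<open>A(x')\<close> is
  positive semidefinite.
\<close>

section \<open>Cubic polynomial functions\<close>

text \<open>Phrased for functions so that no polynomial ever has to be written out: \<open>p\<close>
  arises from closure properties. Equality is demanded on all vectors, of whatever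
  dimension.\<close>

definition cubic_function :: "nat \<Rightarrow> (real Matrix.vec \<Rightarrow> real) \<Rightarrow> bool" where
  "cubic_function N f \<longleftrightarrow> (\<exists>p. cubic_polynomial N p \<and> mpoly_eval p = f)"

text \<open>Coefficients off the support are zero. The larger index set is needed for sums, whose
  support can shrink by cancellation.\<close>

lemma mpoly_eval_superset:
  assumes "finite K" "Poly_Mapping.keys p \<subseteq> K"
  shows "mpoly_eval p w = (\<Sum>\<alpha>\<in>K. Poly_Mapping.lookup p \<alpha> *
      (\<Prod>i\<in>Poly_Mapping.keys \<alpha>. vec_index w i ^ Poly_Mapping.lookup \<alpha> i))"
  unfolding mpoly_eval_def using assms
  by (intro sum.mono_neutral_left) (auto simp: in_keys_iff)

lemma mpoly_eval_add: "mpoly_eval (p + q) w = mpoly_eval p w + mpoly_eval q w"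
proof -
  let ?K = "Poly_Mapping.keys p \<union> Poly_Mapping.keys q"
  have K: "finite ?K" by simp
  show ?thesis
    using mpoly_eval_superset[OF K, of p w] mpoly_eval_superset[OF K, of q w]
      mpoly_eval_superset[OF K Poly_Mapping.keys_add, of w]
    by (simp add: lookup_add distrib_right sum.distrib)
qed

lemma cubic_function_add:
  assumes "cubic_function N f" "cubic_function N g"
  shows "cubic_function N (\<lambda>w. f w + g w)"
proof -
  obtain p q where p: "cubic_polynomial N p" "mpoly_eval p = f"
    and q: "cubic_polynomial N q" "mpoly_eval q = g"
    using assms unfolding cubic_function_def by blast
  have "cubic_polynomial N (p + q)"
    using p(1) q(1) Poly_Mapping.keys_add[of p q] unfolding cubic_polynomial_def by blast
  moreover have "mpoly_eval (p + q) = (\<lambda>w. f w + g w)"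
    using p(2) q(2) by (auto simp: mpoly_eval_add)
  ultimately show ?thesis unfolding cubic_function_def by blast
qed

lemma cubic_function_sum:
  assumes "\<And>i. i \<in> I \<Longrightarrow> cubic_function N (f i)"
  shows "cubic_function N (\<lambda>w. \<Sum>i\<in>I. f i w)"
proof -
  \<comment> \<open>Serves for the empty index set and also for an infinite one, where the sum is 0
    by convention.\<close>
  have zero: "cubic_function N (\<lambda>w. 0)"
    unfolding cubic_function_def cubic_polynomial_def mpoly_eval_def
    by (intro exI[of _ 0]) simp
  show ?thesis
    using assms by (induct I rule: infinite_finite_induct) (simp_all add: zero cubic_function_add)
qed

section \<open>Monomials of low degree\<close>

lemma monomial_eval_superset:
  assumes "finite K" "Poly_Mapping.keys \<alpha> \<subseteq> K"
  shows "(\<Prod>i\<in>Poly_Mapping.keys \<alpha>. vec_index w i ^ Poly_Mapping.lookup \<alpha> i) =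
    (\<Prod>i\<in>K. (vec_index w i :: real) ^ Poly_Mapping.lookup \<alpha> i)"
  using assms by (intro prod.mono_neutral_left) (auto simp: in_keys_iff)

lemma monomial_eval_add:
  "(\<Prod>i\<in>Poly_Mapping.keys (\<alpha> + \<beta>). (vec_index w i :: real) ^ Poly_Mapping.lookup (\<alpha> + \<beta>) i) =
    (\<Prod>i\<in>Poly_Mapping.keys \<alpha>. vec_index w i ^ Poly_Mapping.lookup \<alpha> i) *
    (\<Prod>i\<in>Poly_Mapping.keys \<beta>. vec_index w i ^ Poly_Mapping.lookup \<beta> i)"
proof -
  let ?K = "Poly_Mapping.keys \<alpha> \<union> Poly_Mapping.keys \<beta>"
  have K: "finite ?K" by simp
  show ?thesis
    using monomial_eval_superset[OF K, of \<alpha> w] monomial_eval_superset[OF K, of \<beta> w]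
      monomial_eval_superset[OF K Poly_Mapping.keys_add, of w]
    by (simp add: lookup_add power_add prod.distrib)
qed

lemma monom_degree_superset:
  assumes "finite K" "Poly_Mapping.keys \<alpha> \<subseteq> K"
  shows "monom_degree \<alpha> = (\<Sum>i\<in>K. Poly_Mapping.lookup \<alpha> i)"
  unfolding monom_degree_def using assms
  by (intro sum.mono_neutral_left) (auto simp: in_keys_iff)

lemma monom_degree_add: "monom_degree (\<alpha> + \<beta>) = monom_degree \<alpha> + monom_degree \<beta>"
proof -
  let ?K = "Poly_Mapping.keys \<alpha> \<union> Poly_Mapping.keys \<beta>"
  have K: "finite ?K" by simp
  show ?thesis
    using monom_degree_superset[OF K, of \<alpha>] monom_degree_superset[OF K, of \<beta>]
      monom_degree_superset[OF K Poly_Mapping.keys_add]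
    by (simp add: lookup_add sum.distrib)
qed

lemma cubic_function_monomial:
  assumes "Poly_Mapping.keys \<alpha> \<subseteq> {..<N}" "monom_degree \<alpha> \<le> 3"
  shows "cubic_function N
    (\<lambda>w. c * (\<Prod>i\<in>Poly_Mapping.keys \<alpha>. vec_index w i ^ Poly_Mapping.lookup \<alpha> i))"
  unfolding cubic_function_def cubic_polynomial_def
  using assms by (intro exI[of _ "Poly_Mapping.single \<alpha> c"]) (auto simp: mpoly_eval_def fun_eq_iff)

text \<open>Adding singleton exponents covers \<open>i = j\<close> as well, so coinciding variables
  need no separate case.\<close>

lemma cubic_function_quadratic_term:
  assumes "i < N" "j < N"
  shows "cubic_function N (\<lambda>w. c * (vec_index w i * vec_index w j))"
proof -
  let ?\<alpha> = "Poly_Mapping.single i 1 + Poly_Mapping.single j (1::nat)"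
  have "Poly_Mapping.keys ?\<alpha> \<subseteq> {..<N}"
    using assms Poly_Mapping.keys_add[of "Poly_Mapping.single i (1::nat)"
        "Poly_Mapping.single j 1"] by auto
  moreover have "monom_degree ?\<alpha> \<le> 3"
    by (simp add: monom_degree_add) (simp add: monom_degree_def)
  ultimately show ?thesis
    using cubic_function_monomial[of ?\<alpha> N c] by (simp add: monomial_eval_add)
qed

lemma cubic_function_cubic_term:
  assumes "i < N" "j < N" "l < N"
  shows "cubic_function N (\<lambda>w. c * (vec_index w i * vec_index w j * vec_index w l))"
proof -
  let ?\<beta> = "Poly_Mapping.single i 1 + Poly_Mapping.single j (1::nat)"
  let ?\<alpha> = "?\<beta> + Poly_Mapping.single l 1"
  have "Poly_Mapping.keys ?\<alpha> \<subseteq> {..<N}"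
    using assms Poly_Mapping.keys_add[of "Poly_Mapping.single i (1::nat)"
        "Poly_Mapping.single j 1"] Poly_Mapping.keys_add[of ?\<beta> "Poly_Mapping.single l 1"] by auto
  moreover have "monom_degree ?\<alpha> \<le> 3"
    by (simp add: monom_degree_add) (simp add: monom_degree_def)
  ultimately show ?thesis
    using cubic_function_monomial[of ?\<alpha> N c] by (simp add: monomial_eval_add)
qed

section \<open>The quadratic form of a matrix pencil\<close>

text \<open>Accepts the concatenation of \<open>x\<close> and \<open>y\<close> as well as
  \<open>x\<close> alone, since only the first \<open>n\<close> coordinates are read.\<close>

definition pencil_entry ::
  "nat \<Rightarrow> (nat \<Rightarrow> real mat) \<Rightarrow> real Matrix.vec \<Rightarrow> nat \<Rightarrow> nat \<Rightarrow> real" where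
  "pencil_entry n A w r c = A 0 $$ (r, c) + (\<Sum>i=1..n. vec_index w (i - 1) * A i $$ (r, c))"

text \<open>The function y^T A(x) y on concatenated vectors, with \<open>y\<close> stored from index
  \<open>n\<close> on.\<close>

definition pencil_form ::
  "nat \<Rightarrow> nat \<Rightarrow> (nat \<Rightarrow> real mat) \<Rightarrow> real Matrix.vec \<Rightarrow> real" where
  "pencil_form n m A w =
    (\<Sum>r<m. \<Sum>c<m. vec_index w (n + r) * vec_index w (n + c) * pencil_entry n A w r c)"

lemma cubic_function_pencil_form: "cubic_function (n + m) (pencil_form n m A)"
proof -
  \<comment> \<open>The constant matrix contributes monomials of degree 2, the other matrices
    monomials of degree 3.\<close>
  have eq: "pencil_form n m A = (\<lambda>w. \<Sum>r<m. \<Sum>c<m.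
      A 0 $$ (r, c) * (vec_index w (n + r) * vec_index w (n + c)) +
      (\<Sum>i=1..n. A i $$ (r, c) * (vec_index w (n + r) * vec_index w (n + c) * vec_index w (i - 1))))"
    by (simp add: pencil_form_def pencil_entry_def distrib_left sum_distrib_left mult_ac fun_eq_iff)
  show ?thesis
    unfolding eq
    by (intro cubic_function_sum cubic_function_add cubic_function_quadratic_term
        cubic_function_cubic_term) auto
qed

lemma pencil_entry_append:
  assumes "x \<in> carrier_vec n"
  shows "pencil_entry n A (x @\<^sub>v y) r c = pencil_entry n A x r c"
proof -
  have "vec_index (x @\<^sub>v y) (i - 1) = vec_index x (i - 1)" if "i \<in> {1..n}" for i
  proof -
    have "i - 1 < n" using that by auto
    then show ?thesis using assms by simp
  qed
  then show ?thesis by (simp add: pencil_entry_def)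
qed

lemma pencil_form_append:
  assumes "x \<in> carrier_vec n" "y \<in> carrier_vec m"
  shows "pencil_form n m A (x @\<^sub>v y) =
    (\<Sum>r<m. \<Sum>c<m. vec_index y r * vec_index y c * pencil_entry n A x r c)"
  unfolding pencil_form_def using assms by (intro sum.cong) (auto simp: pencil_entry_append)

lemma sum_lessThan_add:
  fixes f :: "nat \<Rightarrow> 'a::comm_monoid_add"
  shows "(\<Sum>i<n + m. f i) = (\<Sum>i<n. f i) + (\<Sum>i<m. f (n + i))"
  by (induct m) (simp_all add: ac_simps)

lemma quadratic_form_eq:
  fixes M :: "real mat"
  assumes "M \<in> carrier_mat N N" "v \<in> carrier_vec N"
  shows "scalar_prod v (M *\<^sub>v v) = (\<Sum>i<N. \<Sum>j<N. vec_index v i * vec_index v j * M $$ (i, j))"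
proof -
  have "scalar_prod v (M *\<^sub>v v) = (\<Sum>i<N. vec_index v i * (\<Sum>j<N. M $$ (i, j) * vec_index v j))"
    using assms by (auto simp: scalar_prod_def lessThan_atLeast0 intro!: sum.cong)
  then show ?thesis by (simp add: sum_distrib_left mult_ac)
qed

definition symmetric_matrices :: "nat \<Rightarrow> nat \<Rightarrow> (nat \<Rightarrow> real mat) \<Rightarrow> bool" where
  "symmetric_matrices n m A \<longleftrightarrow>
    (\<forall>i\<le>n. A i \<in> carrier_mat m m \<and> transpose_mat (A i) = A i)"

lemma pencil_entry_sym:
  assumes A: "symmetric_matrices n m A"
    and rc: "r < m" "c < m"
  shows "pencil_entry n A w r c = pencil_entry n A w c r"
proof -
  have "A i $$ (r, c) = A i $$ (c, r)" if "i \<le> n" for i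
    using A that rc unfolding symmetric_matrices_def
    by (metis carrier_matD index_transpose_mat(1))
  then show ?thesis
    unfolding pencil_entry_def by (intro arg_cong2[where f = "(+)"] sum.cong) auto
qed

text \<open>Symmetry of the pencil is inherited from the matrices, which leaves only the sign
  condition. Positive semidefiniteness of the pencil enters later arguments through this
  criterion.\<close>

lemma mem_spectrahedron_iff:
  assumes A: "symmetric_matrices n m A"
    and x: "x \<in> carrier_vec n"
  shows "x \<in> spectrahedron n m A \<longleftrightarrow> (\<forall>y\<in>carrier_vec m. 0 \<le> pencil_form n m A (x @\<^sub>v y))"
proof -
  let ?M = "matrix_pencil n m A x"
  have M: "?M \<in> carrier_mat m m" by (simp add: matrix_pencil_def)
  have entry: "?M $$ (r, c) = pencil_entry n A x r c" if "r < m" "c < m" for r c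
    using that by (simp add: matrix_pencil_def pencil_entry_def)
  have "transpose_mat ?M = ?M"
    using M by (intro eq_matI) (auto simp: entry intro: pencil_entry_sym[OF A])
  moreover have "scalar_prod y (?M *\<^sub>v y) = pencil_form n m A (x @\<^sub>v y)"
    if "y \<in> carrier_vec m" for y
    using that x by (simp add: quadratic_form_eq[OF M] pencil_form_append entry)
  ultimately show ?thesis
    using M x by (simp add: spectrahedron_def psd_def)
qed

section \<open>The Hessian\<close>

text \<open>Coordinate lines through \<open>w\<close> stay in the carrier. This permits iterated
  derivatives, as the first one is computed only on the carrier.\<close>

lemma partial_deriv_cong:
  assumes "\<And>v. v \<in> carrier_vec N \<Longrightarrow> f v = g v" "w \<in> carrier_vec N"
  shows "partial_deriv N i f w = partial_deriv N i g w"
proof -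
  have "f (w + t \<cdot>\<^sub>v unit_vec N i) = g (w + t \<cdot>\<^sub>v unit_vec N i)" for t
    using assms by simp
  then show ?thesis unfolding partial_deriv_def by simp
qed

text \<open>The partial derivative of \<open>pencil_entry\<close> in variable \<open>j\<close>: the
  entry of \<open>A (j + 1)\<close> if \<open>j < n\<close>, and 0 if \<open>j\<close> belongs to
  the \<open>y\<close> block. The indicator avoids a case split.\<close>

definition pencil_slope :: "nat \<Rightarrow> (nat \<Rightarrow> real mat) \<Rightarrow> nat \<Rightarrow> nat \<Rightarrow> nat \<Rightarrow> real" where
  "pencil_slope n A j r c = (\<Sum>i=1..n. of_bool (i - 1 = j) * A i $$ (r, c))"

lemma index_shift:
  assumes "w \<in> carrier_vec N" "i < N"
  shows "vec_index (w + t \<cdot>\<^sub>v unit_vec N j) i = vec_index w i + t * of_bool (i = j)"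
  using assms by (auto simp: unit_vec_def)

lemma pencil_entry_shift:
  assumes "w \<in> carrier_vec (n + m)"
  shows "pencil_entry n A (w + t \<cdot>\<^sub>v unit_vec (n + m) j) r c =
    pencil_entry n A w r c + t * pencil_slope n A j r c"
proof -
  have "(\<Sum>i=1..n. vec_index (w + t \<cdot>\<^sub>v unit_vec (n + m) j) (i - 1) * A i $$ (r, c)) =
    (\<Sum>i=1..n. vec_index w (i - 1) * A i $$ (r, c) + t * (of_bool (i - 1 = j) * A i $$ (r, c)))"
    by (intro sum.cong refl, subst index_shift[OF assms]) (auto simp: algebra_simps)
  then show ?thesis
    unfolding pencil_entry_def pencil_slope_def
    by (simp only: sum.distrib sum_distrib_left add.assoc)
qed

text \<open>The product rule, with \<open>of_bool (n + r = j)\<close> as the derivative of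
  coordinate \<open>n + r\<close> in direction \<open>j\<close>.\<close>

definition pencil_form_gradient ::
  "nat \<Rightarrow> nat \<Rightarrow> (nat \<Rightarrow> real mat) \<Rightarrow> nat \<Rightarrow> real Matrix.vec \<Rightarrow> real" where
  "pencil_form_gradient n m A j w = (\<Sum>r<m. \<Sum>c<m.
     (of_bool (n + r = j) * vec_index w (n + c) + vec_index w (n + r) * of_bool (n + c = j)) *
       pencil_entry n A w r c +
     vec_index w (n + r) * vec_index w (n + c) * pencil_slope n A j r c)"

lemma partial_deriv_pencil_form:
  assumes w: "w \<in> carrier_vec (n + m)"
  shows "partial_deriv (n + m) j (pencil_form n m A) w = pencil_form_gradient n m A j w"
proof -
  \<comment> \<open>Along a coordinate line every factor is affine in \<open>t\<close>, so the
    restricted form is an explicit polynomial in \<open>t\<close>.\<close>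
  let ?a = "\<lambda>r t. vec_index w (n + r) + t * of_bool (n + r = j)"
  let ?P = "\<lambda>r c t. pencil_entry n A w r c + t * pencil_slope n A j r c"
  have eq: "(\<lambda>t. pencil_form n m A (w + t \<cdot>\<^sub>v unit_vec (n + m) j)) =
      (\<lambda>t. \<Sum>r<m. \<Sum>c<m. ?a r t * ?a c t * ?P r c t)"
    unfolding pencil_form_def pencil_entry_shift[OF w]
    by (intro ext sum.cong refl) (simp only: index_shift[OF w] lessThan_iff nat_add_left_cancel_less)
  have "((\<lambda>t. \<Sum>r<m. \<Sum>c<m. ?a r t * ?a c t * ?P r c t) has_field_derivative
      pencil_form_gradient n m A j w) (at 0)"
    unfolding pencil_form_gradient_def
    by (intro DERIV_sum) (auto intro!: derivative_eq_intros simp: algebra_simps)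
  then show ?thesis
    unfolding partial_deriv_def eq by (rule DERIV_imp_deriv)
qed

text \<open>First the product of coordinates differentiated twice, then the two mixed terms. The
  entries are affine and have no second derivative.\<close>

definition pencil_form_second ::
  "nat \<Rightarrow> nat \<Rightarrow> (nat \<Rightarrow> real mat) \<Rightarrow> nat \<Rightarrow> nat \<Rightarrow> real Matrix.vec \<Rightarrow> real" where
  "pencil_form_second n m A i j w = (\<Sum>r<m. \<Sum>c<m.
     (of_bool (n + r = j) * of_bool (n + c = i) + of_bool (n + r = i) * of_bool (n + c = j)) *
       pencil_entry n A w r c +
     (of_bool (n + r = j) * vec_index w (n + c) + vec_index w (n + r) * of_bool (n + c = j)) *
       pencil_slope n A i r c +
     (of_bool (n + r = i) * vec_index w (n + c) + vec_index w (n + r) * of_bool (n + c = i)) *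
       pencil_slope n A j r c)"

lemma partial_deriv_pencil_form_gradient:
  assumes w: "w \<in> carrier_vec (n + m)"
  shows "partial_deriv (n + m) i (pencil_form_gradient n m A j) w = pencil_form_second n m A i j w"
proof -
  let ?a = "\<lambda>r t. vec_index w (n + r) + t * of_bool (n + r = i)"
  let ?P = "\<lambda>r c t. pencil_entry n A w r c + t * pencil_slope n A i r c"
  let ?g = "\<lambda>t. \<Sum>r<m. \<Sum>c<m.
     (of_bool (n + r = j) * ?a c t + ?a r t * of_bool (n + c = j)) * ?P r c t +
     ?a r t * ?a c t * pencil_slope n A j r c"
  have eq: "(\<lambda>t. pencil_form_gradient n m A j (w + t \<cdot>\<^sub>v unit_vec (n + m) i)) = ?g"
    unfolding pencil_form_gradient_def pencil_entry_shift[OF w]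
    by (intro ext sum.cong refl) (simp only: index_shift[OF w] lessThan_iff nat_add_left_cancel_less)
  have "(?g has_field_derivative pencil_form_second n m A i j w) (at 0)"
    unfolding pencil_form_second_def
    by (intro DERIV_sum) (auto intro!: derivative_eq_intros simp: algebra_simps)
  then show ?thesis
    unfolding partial_deriv_def eq by (rule DERIV_imp_deriv)
qed

lemma hessian_pencil_form:
  assumes "w \<in> carrier_vec (n + m)" "i < n + m" "j < n + m"
  shows "hessian (n + m) (pencil_form n m A) w $$ (i, j) = pencil_form_second n m A i j w"
proof -
  have "partial_deriv (n + m) i (partial_deriv (n + m) j (pencil_form n m A)) w =
      partial_deriv (n + m) i (pencil_form_gradient n m A j) w"
    using assms(1) by (intro partial_deriv_cong partial_deriv_pencil_form)
  then show ?thesis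
    using assms by (simp add: hessian_def partial_deriv_pencil_form_gradient)
qed

text \<open>Mixed terms carry a coordinate of \<open>y\<close> and a slope: the former vanishes at
  \<open>y = 0\<close>, the latter in \<open>y\<close> directions. Either alternative of the last
  assumption therefore leaves only the twice differentiated product.\<close>

lemma pencil_form_second_eq:
  assumes A: "symmetric_matrices n m A"
    and ij: "i < n + m" "j < n + m"
    and *: "(\<forall>r<m. vec_index w (n + r) = 0) \<or> (n \<le> i \<and> n \<le> j)"
  shows "pencil_form_second n m A i j w =
    (if n \<le> i \<and> n \<le> j then 2 * pencil_entry n A w (i - n) (j - n) else 0)"
proof -
  have slope: "pencil_slope n A l r c = 0" if "n \<le> l" for l r c
    unfolding pencil_slope_def using that by (intro sum.neutral) auto
  have "pencil_form_second n m A i j w = (\<Sum>r<m. \<Sum>c<m.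
     (of_bool (n + r = j) * of_bool (n + c = i) + of_bool (n + r = i) * of_bool (n + c = j)) *
       pencil_entry n A w r c)"
    unfolding pencil_form_second_def using * by (intro sum.cong) (auto simp: slope)
  also have "\<dots> = (if n \<le> i \<and> n \<le> j then 2 * pencil_entry n A w (i - n) (j - n) else 0)"
  proof (cases "n \<le> i \<and> n \<le> j")
    case True
    then obtain s t where st: "i = n + s" "j = n + t" by (auto simp: le_iff_add)
    have lt: "s < m" "t < m" using ij st by auto
    \<comment> \<open>The indicators select the entries \<open>(t, s)\<close> and
      \<open>(s, t)\<close>, equal by symmetry; hence the factor 2.\<close>
    show ?thesis
      using lt pencil_entry_sym[OF A lt, of w]
      by (simp add: st distrib_right sum.distrib mult.assoc flip: sum_distrib_left)
  next
    \<comment> \<open>An index below \<open>n\<close> never has the form \<open>n + r\<close>, so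
      one indicator in each product is 0.\<close>
    case False
    then show ?thesis by (subst if_not_P) (auto intro!: sum.neutral)
  qed
  finally show ?thesis .
qed

section \<open>Projection of the convexity region\<close>

text \<open>Test vectors with zero \<open>x\<close> part see only the \<open>yy\<close> block of the
  Hessian, which is twice the pencil whatever \<open>y\<close> is.\<close>

lemma convexity_region_imp_spectrahedron:
  assumes A: "symmetric_matrices n m A"
    and p: "mpoly_eval p = pencil_form n m A"
    and x: "x \<in> carrier_vec n" and y: "y \<in> carrier_vec m"
    and cr: "x @\<^sub>v y \<in> convexity_region (n + m) p"
  shows "x \<in> spectrahedron n m A"
  unfolding mem_spectrahedron_iff[OF A x]
proof
  fix z :: "real Matrix.vec" assume z: "z \<in> carrier_vec m"
  let ?w = "x @\<^sub>v y" and ?v = "0\<^sub>v n @\<^sub>v z"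
  let ?H = "hessian (n + m) (pencil_form n m A) ?w"
  have w: "?w \<in> carrier_vec (n + m)" and v: "?v \<in> carrier_vec (n + m)" using x y z by auto
  have H: "?H \<in> carrier_mat (n + m) (n + m)" by (simp add: hessian_def)
  have "0 \<le> scalar_prod ?v (?H *\<^sub>v ?v)"
    using cr v unfolding convexity_region_def psd_def p by blast
  also have "\<dots> = (\<Sum>r<m. \<Sum>c<m. vec_index z r * vec_index z c * ?H $$ (n + r, n + c))"
    using z by (simp add: quadratic_form_eq[OF H v] sum_lessThan_add)
  also have "\<dots> = (\<Sum>r<m. \<Sum>c<m. vec_index z r * vec_index z c * (2 * pencil_entry n A x r c))"
    using w x by (intro sum.cong)
      (auto simp: hessian_pencil_form pencil_form_second_eq[OF A] pencil_entry_append)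
  also have "\<dots> = 2 * pencil_form n m A (x @\<^sub>v z)"
    using x z by (simp add: pencil_form_append sum_distrib_left mult_ac)
  finally show "0 \<le> pencil_form n m A (x @\<^sub>v z)" by simp
qed

text \<open>At \<open>y = 0\<close> the Hessian is block diagonal, with a zero block and twice the
  pencil.\<close>

lemma spectrahedron_imp_convexity_region:
  assumes A: "symmetric_matrices n m A"
    and p: "mpoly_eval p = pencil_form n m A"
    and x: "x \<in> carrier_vec n" and S: "x \<in> spectrahedron n m A"
  shows "x @\<^sub>v 0\<^sub>v m \<in> convexity_region (n + m) p"
proof -
  let ?w = "x @\<^sub>v 0\<^sub>v m"
  let ?H = "hessian (n + m) (pencil_form n m A) ?w"
  have w: "?w \<in> carrier_vec (n + m)" using x by auto
  have H: "?H \<in> carrier_mat (n + m) (n + m)" by (simp add: hessian_def)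
  have entry: "?H $$ (i, j) =
      (if n \<le> i \<and> n \<le> j then 2 * pencil_entry n A x (i - n) (j - n) else 0)"
    if "i < n + m" "j < n + m" for i j
    using that w x
    by (subst hessian_pencil_form) (auto simp: pencil_form_second_eq[OF A] pencil_entry_append)
  have "transpose_mat ?H = ?H"
    using H by (intro eq_matI) (auto simp: entry intro!: pencil_entry_sym[OF A])
  moreover have "0 \<le> scalar_prod v (?H *\<^sub>v v)" if v: "v \<in> carrier_vec (n + m)" for v
  proof -
    \<comment> \<open>Only the \<open>y\<close> part of \<open>v\<close> meets the nonzero
      block.\<close>
    define z where "z = vec_last v m"
    have z: "z \<in> carrier_vec m" by (simp add: z_def)
    have zi: "vec_index v (n + r) = vec_index z r" if "r < m" for r
      using that v by (simp add: z_def vec_last_def)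
    have "scalar_prod v (?H *\<^sub>v v) =
        (\<Sum>r<m. \<Sum>c<m. vec_index z r * vec_index z c * (2 * pencil_entry n A x r c))"
      by (simp add: quadratic_form_eq[OF H v] sum_lessThan_add entry zi)
    also have "\<dots> = 2 * pencil_form n m A (x @\<^sub>v z)"
      using x z by (simp add: pencil_form_append sum_distrib_left mult_ac)
    finally show ?thesis
      using S z unfolding mem_spectrahedron_iff[OF A x] by simp
  qed
  ultimately show ?thesis
    using w H unfolding convexity_region_def psd_def p by simp
qed

section \<open>Local minima\<close>

lemma euclid_dist_append:
  assumes "x \<in> carrier_vec n" "x' \<in> carrier_vec n" "y \<in> carrier_vec m" "y' \<in> carrier_vec m"
  shows "euclid_dist (n + m) (x @\<^sub>v y) (x' @\<^sub>v y') =
    sqrt ((euclid_dist n x x')\<^sup>2 + (euclid_dist m y y')\<^sup>2)"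
  using assms by (simp add: euclid_dist_def L2_set_def sum_lessThan_add sum_nonneg)

lemma euclid_dist_nonneg: "0 \<le> euclid_dist n x y"
  by (simp add: euclid_dist_def)

text \<open>Lets the \<open>x\<close> and \<open>y\<close> displacements of a test point be budgeted
  separately.\<close>

lemma euclid_dist_append_le:
  assumes "x \<in> carrier_vec n" "x' \<in> carrier_vec n" "y \<in> carrier_vec m" "y' \<in> carrier_vec m"
  shows "euclid_dist (n + m) (x @\<^sub>v y) (x' @\<^sub>v y') \<le> euclid_dist n x x' + euclid_dist m y y'"
  unfolding euclid_dist_append[OF assms]
  by (rule sqrt_sum_squares_le_sum) (rule euclid_dist_nonneg)+

text \<open>Projection onto \<open>x\<close> does not increase distances, so points near
  \<open>(x, 0)\<close> project to points near \<open>x\<close>.\<close>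

lemma euclid_dist_le_append:
  assumes "x \<in> carrier_vec n" "x' \<in> carrier_vec n" "y \<in> carrier_vec m" "y' \<in> carrier_vec m"
  shows "euclid_dist n x x' \<le> euclid_dist (n + m) (x @\<^sub>v y) (x' @\<^sub>v y')"
  unfolding euclid_dist_append[OF assms] by (rule real_sqrt_sum_squares_ge1)

lemma euclid_dist_add_smult:
  assumes "y \<in> carrier_vec m" "z \<in> carrier_vec m"
  shows "euclid_dist m (y + t \<cdot>\<^sub>v z) y = \<bar>t\<bar> * L2_set (vec_index z) {..<m}"
proof -
  have "euclid_dist m (y + t \<cdot>\<^sub>v z) y = L2_set (\<lambda>i. t * vec_index z i) {..<m}"
    unfolding euclid_dist_def using assms by (intro L2_set_cong) auto
  then show ?thesis
    by (simp add: L2_set_def power_mult_distrib real_sqrt_mult flip: sum_distrib_left)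
qed

lemma euclid_interior_iff:
  assumes "x \<in> carrier_vec n" "S \<subseteq> carrier_vec n"
  shows "x \<in> (euclid_topology n) interior_of S \<longleftrightarrow>
    (\<exists>\<delta>>0. \<forall>x'\<in>carrier_vec n. euclid_dist n x' x < \<delta> \<longrightarrow> x' \<in> S)"
proof -
  interpret Metric_space "carrier_vec n" "euclid_dist n" by (rule Metric_space_euclid_dist)
  have "x \<in> mtopology interior_of S \<longleftrightarrow> (\<exists>\<delta>>0. mball x \<delta> \<subseteq> S)"
  proof
    assume "x \<in> mtopology interior_of S"
    then show "\<exists>\<delta>>0. mball x \<delta> \<subseteq> S"
      unfolding interior_of_def openin_mtopology by simp (meson subset_trans)
  next
    assume "\<exists>\<delta>>0. mball x \<delta> \<subseteq> S"
    then show "x \<in> mtopology interior_of S"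
      unfolding interior_of_def using assms(1) openin_mball centre_in_mball_iff by blast
  qed
  then show ?thesis
    using assms(1) by (auto simp: euclid_topology_def commute in_mball subset_iff)
qed

section \<open>Symmetry identities of the form\<close>

lemma pencil_entry_reflect:
  assumes "x \<in> carrier_vec n" "x' \<in> carrier_vec n"
  shows "pencil_entry n A (2 \<cdot>\<^sub>v x - x') r c = 2 * pencil_entry n A x r c - pencil_entry n A x' r c"
proof -
  have "(\<Sum>i=1..n. vec_index (2 \<cdot>\<^sub>v x - x') (i - 1) * A i $$ (r, c)) =
    (\<Sum>i=1..n. 2 * (vec_index x (i - 1) * A i $$ (r, c)) - vec_index x' (i - 1) * A i $$ (r, c))"
    using assms by (intro sum.cong) (auto simp: algebra_simps)
  then show ?thesis
    by (simp add: pencil_entry_def sum_subtractf flip: sum_distrib_left)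
qed

text \<open>The form is affine in its first argument and \<open>x\<close> is the midpoint of
  \<open>x'\<close> and its mirror image. A lower bound at the mirror image thus becomes an upper
  bound at \<open>x'\<close>.\<close>

lemma pencil_form_reflect:
  assumes "x \<in> carrier_vec n" "x' \<in> carrier_vec n" "y \<in> carrier_vec m"
  shows "pencil_form n m A ((2 \<cdot>\<^sub>v x - x') @\<^sub>v y) =
    2 * pencil_form n m A (x @\<^sub>v y) - pencil_form n m A (x' @\<^sub>v y)"
  using assms
  by (simp add: pencil_form_append pencil_entry_reflect right_diff_distrib sum_subtractf
      sum_distrib_left mult_ac)

text \<open>The cross terms in \<open>y\<close> and \<open>z\<close> cancel, which isolates the
  value at \<open>z\<close> from values near \<open>y\<close>.\<close>

lemma pencil_form_parallelogram:
  assumes "x \<in> carrier_vec n" "y \<in> carrier_vec m" "z \<in> carrier_vec m"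
  shows "pencil_form n m A (x @\<^sub>v (y + t \<cdot>\<^sub>v z)) + pencil_form n m A (x @\<^sub>v (y + (- t) \<cdot>\<^sub>v z)) =
    2 * pencil_form n m A (x @\<^sub>v y) + 2 * t\<^sup>2 * pencil_form n m A (x @\<^sub>v z)"
proof -
  have "y + s \<cdot>\<^sub>v z \<in> carrier_vec m" for s using assms by simp
  then show ?thesis
    using assms
    by (simp add: pencil_form_append sum_distrib_left flip: sum.distrib)
      (auto simp: algebra_simps power2_eq_square intro!: sum.cong)
qed

lemma local_minimum_imp_interior:
  assumes A: "symmetric_matrices n m A"
    and p: "mpoly_eval p = pencil_form n m A"
    and x: "x \<in> carrier_vec n" and y: "y \<in> carrier_vec m"
    and lm: "x @\<^sub>v y \<in> local_minima (n + m) p"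
  shows "x \<in> (euclid_topology n) interior_of (spectrahedron n m A)"
proof -
  let ?q = "\<lambda>x y. pencil_form n m A (x @\<^sub>v y)"
  obtain \<epsilon> where \<epsilon>: "\<epsilon> > 0" and min: "\<And>v. v \<in> carrier_vec (n + m) \<Longrightarrow>
      euclid_dist (n + m) v (x @\<^sub>v y) \<le> \<epsilon> \<Longrightarrow> ?q x y \<le> pencil_form n m A v"
    using lm unfolding local_minima_def p by auto
  have min2: "?q x y \<le> ?q x' y'"
    if "x' \<in> carrier_vec n" "y' \<in> carrier_vec m" "euclid_dist n x' x + euclid_dist m y' y \<le> \<epsilon>" for x' y'
    using that euclid_dist_append_le[OF that(1) x that(2) y] by (intro min) auto
  have dist_self: "euclid_dist m y y = 0" by (simp add: euclid_dist_def L2_set_def)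
  have "x' \<in> spectrahedron n m A"
    if x': "x' \<in> carrier_vec n" and d: "euclid_dist n x' x < \<epsilon> / 2" for x'
    unfolding mem_spectrahedron_iff[OF A x']
  proof
    fix z :: "real Matrix.vec" assume z: "z \<in> carrier_vec m"
    \<comment> \<open>The mirror image of \<open>x'\<close> is equally close to \<open>x\<close>, so
      minimality applies to it.\<close>
    have "euclid_dist n (2 \<cdot>\<^sub>v x - x') x = euclid_dist n x' x"
      unfolding euclid_dist_def L2_set_def using x x'
      by (intro arg_cong[where f = sqrt] sum.cong) (auto simp: power2_commute)
    then have "?q x y \<le> ?q (2 \<cdot>\<^sub>v x - x') y"
      using x x' y d \<epsilon> dist_self by (intro min2) auto
    then have q: "?q x' y \<le> ?q x y"
      by (simp add: pencil_form_reflect[OF x x' y])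
    let ?L = "L2_set (vec_index z) {..<m}"
    \<comment> \<open>The summand 1 keeps the denominator positive when \<open>L = 0\<close>, that
      is, for \<open>z = 0\<close>.\<close>
    have "\<exists>t>0. t * L \<le> \<epsilon> / 2" if "L \<ge> 0" for L
      using that \<epsilon> by (intro exI[of _ "\<epsilon> / (2 * (L + 1))"]) (auto simp: field_simps)
    then obtain t where t: "t > 0" and "t * ?L \<le> \<epsilon> / 2" using L2_set_nonneg by blast
    \<comment> \<open>Each displacement, of \<open>x\<close> and of \<open>y\<close>, uses at most
      half of \<open>\<epsilon>\<close>.\<close>
    then have "?q x y \<le> ?q x' (y + s \<cdot>\<^sub>v z)" if "\<bar>s\<bar> = t" for s
      using that x' y z d by (intro min2) (auto simp: euclid_dist_add_smult)
    \<comment> \<open>The two values sum to at least \<open>2 * ?q x y\<close>, hence to at least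
      \<open>2 * ?q x' y\<close>; the parallelogram identity leaves the term in
      \<open>z\<close>.\<close>
    from this[of t] this[of "- t"] q t
    have "0 \<le> 2 * t\<^sup>2 * ?q x' z"
      using pencil_form_parallelogram[OF x' y z, of A t] by simp
    then show "0 \<le> ?q x' z" using t by (simp add: zero_le_mult_iff)
  qed
  moreover have "spectrahedron n m A \<subseteq> carrier_vec n" by (auto simp: spectrahedron_def)
  ultimately show ?thesis
    using \<epsilon> by (subst euclid_interior_iff[OF x]) (auto intro!: exI[of _ "\<epsilon> / 2"])
qed

lemma interior_imp_local_minimum:
  assumes A: "symmetric_matrices n m A"
    and p: "mpoly_eval p = pencil_form n m A"
    and x: "x \<in> carrier_vec n"
    and int: "x \<in> (euclid_topology n) interior_of (spectrahedron n m A)"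
  shows "x @\<^sub>v 0\<^sub>v m \<in> local_minima (n + m) p"
proof -
  have "spectrahedron n m A \<subseteq> carrier_vec n" by (auto simp: spectrahedron_def)
  then obtain \<delta> where \<delta>: "\<delta> > 0" and near: "\<And>x'. x' \<in> carrier_vec n \<Longrightarrow>
      euclid_dist n x' x < \<delta> \<Longrightarrow> x' \<in> spectrahedron n m A"
    using int euclid_interior_iff[OF x] by blast
  \<comment> \<open>Halving \<open>\<delta>\<close> fits the closed ball of
    \<open>local_minima\<close> into the open ball describing the interior.\<close>
  have "pencil_form n m A (x @\<^sub>v 0\<^sub>v m) \<le> pencil_form n m A v"
    if v: "v \<in> carrier_vec (n + m)" and d: "euclid_dist (n + m) v (x @\<^sub>v 0\<^sub>v m) \<le> \<delta> / 2" for v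
  proof -
    obtain x' y' where v_eq: "v = x' @\<^sub>v y'" and x': "x' \<in> carrier_vec n" and y': "y' \<in> carrier_vec m"
      using vec_first_last_append[OF v] vec_first_carrier vec_last_carrier by metis
    have "euclid_dist n x' x < \<delta>"
      using euclid_dist_le_append[OF x' x y' zero_carrier_vec] d \<delta> unfolding v_eq by linarith
    then have "0 \<le> pencil_form n m A v"
      using near[OF x'] y' unfolding v_eq mem_spectrahedron_iff[OF A x'] by blast
    then show ?thesis using x by (simp add: pencil_form_append)
  qed
  then show ?thesis
    using \<delta> x unfolding local_minima_def p by (auto intro!: exI[of _ "\<delta> / 2"])
qed

theorem theorem4p12:
  fixes n m :: nat and A :: "nat \<Rightarrow> real mat" and S :: "real Matrix.vec set"
  assumes "\<And>i. i \<le> n \<Longrightarrow> A i \<in> carrier_mat m m"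
    and "\<And>i. i \<le> n \<Longrightarrow> transpose_mat (A i) = A i"
    and "S = spectrahedron n m A"
  shows "\<exists>k p. k \<le> m \<and> cubic_polynomial (n + k) p \<and>
    S = {x \<in> carrier_vec n. \<exists>y\<in>carrier_vec k. x @\<^sub>v y \<in> convexity_region (n + k) p} \<and>
    (euclid_topology n) interior_of S =
      {x \<in> carrier_vec n. \<exists>y\<in>carrier_vec k. x @\<^sub>v y \<in> local_minima (n + k) p}"
proof -
  have A: "symmetric_matrices n m A" using assms(1,2) by (simp add: symmetric_matrices_def)
  obtain p where cubic: "cubic_polynomial (n + m) p" and p: "mpoly_eval p = pencil_form n m A"
    using cubic_function_pencil_form unfolding cubic_function_def by blast
  \<comment> \<open>The projections are sets of carrier vectors, so \<open>S\<close> and its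
    interior must be known to lie in the carrier. The witness in both equalities is
    \<open>y = 0\<close>.\<close>
  have sub: "S \<subseteq> carrier_vec n" by (auto simp: assms(3) spectrahedron_def)
  have "S = {x \<in> carrier_vec n. \<exists>y\<in>carrier_vec m. x @\<^sub>v y \<in> convexity_region (n + m) p}"
    using sub convexity_region_imp_spectrahedron[OF A p]
      spectrahedron_imp_convexity_region[OF A p] zero_carrier_vec[of m]
    unfolding assms(3) by blast
  moreover have "(euclid_topology n) interior_of S =
      {x \<in> carrier_vec n. \<exists>y\<in>carrier_vec m. x @\<^sub>v y \<in> local_minima (n + m) p}"
    using sub interior_of_subset[of "euclid_topology n" S]
      local_minimum_imp_interior[OF A p]
      interior_imp_local_minimum[OF A p] zero_carrier_vec[of m]
    unfolding assms(3) by blast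
  ultimately show ?thesis
    using cubic by blast
qed

end
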